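(* Any metric space $X$ of countable asymptotic dimension has Property A.
   Context: For a set $S$, $\Delta(S)$ is the subspace of $l_1(S)$ (with the $l_1$ metric) consisting of functions $f:S\to[0,1]$ of finite support with $\sum_{v\in S}f(v)=1$. The star $st(v)$ of $v\in S$ is $\{f\in\Delta(S): f(v)>0\}$. A partition of unity on a metric space $X$ is a function $f:X\to\Delta(S)$ for some set $S$. It is barycentric if $f(x)(v)=f(x)(w)$ whenever $f(x)(v)>0$ and $f(x)(w)>0$. It is cobounded if there is $M>0$ with $\mathrm{diam}(f^{-1}(st(v)))\leq M$ for all $v\in S$. It is $(\lambda,C)$-Lipschitz if $\|f(x)-f(y)\|_1\leq\lambda\, d(x,y)+C$ for all $x,y\in X$. Property A: $X$ has Property A if for each $\epsilon>0$ there is an $(\epsilon,\epsilon)$-Lipschitz barycentric partition of unity $f:X\to\Delta(S)$ (for some set $S$) that is cobounded. Given $R>0$, a family $\{U_s\}_{s\in S}$ of subsets of $X$ is $R$-disjoint if $d(x,y)>R$ whenever $x\in U_s$, $y\in U_t$, $s\neq t$. A family of subsets is uniformly bounded if there is a common finite upper bound for the diameters of its elements. Countable asymptotic dimension: $X$ is of countable asymptotic dimension if there is a sequence of integers $n_i\geq1$, $i\geq1$, such that for any sequence of positive real numbers $R_i$, $i\geq1$, there is a sequence $\mathcal V_i$, $i\geq 1$, of families of subsets of $X$ such that: (1) $\mathcal V_1=\{X\}$; (2) for each $i$, each $U\in\mathcal V_i$ can be expressed as the union of (all the members of) at most $n_i$ subfamilies of $\mathcal V_{i+1}$, each of which is $R_i$-disjoint;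 (3) at least one of the families $\mathcal V_i$ is uniformly bounded. *)

theory Defs
  imports "HOL-Analysis.Analysis"
begin

section \<open>Diameters\<close>

text \<open>Extended-valued, so that unbounded sets have diameter \<open>\<infinity>\<close>
  (the library's \<open>diameter\<close> is real-valued and unspecified for unbounded sets).
  The empty set has diameter 0.\<close>

definition ediam :: "('a \<Rightarrow> 'a \<Rightarrow> real) \<Rightarrow> 'a set \<Rightarrow> ennreal" where
  "ediam d A = (SUP x\<in>A. SUP y\<in>A. ennreal (d x y))"

lemma ediam_le_iff:
  assumes "0 \<le> B"
  shows "ediam d A \<le> ennreal B \<longleftrightarrow> (\<forall>x\<in>A. \<forall>y\<in>A. d x y \<le> B)"
  using assms by (simp add: ediam_def SUP_le_iff ennreal_le_iff)

definition uniformly_bounded_family :: "('a \<Rightarrow> 'a \<Rightarrow> real) \<Rightarrow> 'a set set \<Rightarrow> bool" where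
  "uniformly_bounded_family d \<U> \<longleftrightarrow> (\<exists>B::real. \<forall>U\<in>\<U>. ediam d U \<le> ennreal B)"

section \<open>Partitions of unity and Property A\<close>

text \<open>Functions \<open>S \<rightarrow> [0,1]\<close> are extended by 0 outside \<open>S\<close>.\<close>

definition Delta :: "'s set \<Rightarrow> ('s \<Rightarrow> real) set" where
  "Delta S = {f. f \<in> S \<rightarrow> {0..1} \<and> (\<forall>v. v \<notin> S \<longrightarrow> f v = 0) \<and>
     finite {v\<in>S. f v \<noteq> 0} \<and> (\<Sum>v\<in>{v\<in>S. f v \<noteq> 0}. f v) = 1}"

definition l1_dist :: "'s set \<Rightarrow> ('s \<Rightarrow> real) \<Rightarrow> ('s \<Rightarrow> real) \<Rightarrow> real" where
  "l1_dist S f g = (\<Sum>\<^sub>\<infinity>v\<in>S. \<bar>f v - g v\<bar>)"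

definition st :: "'s set \<Rightarrow> 's \<Rightarrow> ('s \<Rightarrow> real) set" where
  "st S v = {f \<in> Delta S. f v > 0}"

definition partition_of_unity :: "'a set \<Rightarrow> 's set \<Rightarrow> ('a \<Rightarrow> 's \<Rightarrow> real) \<Rightarrow> bool" where
  "partition_of_unity X S f \<longleftrightarrow> f \<in> X \<rightarrow> Delta S"

definition barycentric :: "'a set \<Rightarrow> 's set \<Rightarrow> ('a \<Rightarrow> 's \<Rightarrow> real) \<Rightarrow> bool" where
  "barycentric X S f \<longleftrightarrow>
     (\<forall>x\<in>X. \<forall>v\<in>S. \<forall>w\<in>S. f x v > 0 \<and> f x w > 0 \<longrightarrow> f x v = f x w)"

definition cobounded ::
  "'a set \<Rightarrow> ('a \<Rightarrow> 'a \<Rightarrow> real) \<Rightarrow> 's set \<Rightarrow> ('a \<Rightarrow> 's \<Rightarrow> real) \<Rightarrow> bool" where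
  "cobounded X d S f \<longleftrightarrow>
     (\<exists>M::real. M > 0 \<and> (\<forall>v\<in>S. ediam d (X \<inter> f -` st S v) \<le> ennreal M))"

definition lipschitz_pou ::
  "real \<Rightarrow> real \<Rightarrow> 'a set \<Rightarrow> ('a \<Rightarrow> 'a \<Rightarrow> real) \<Rightarrow> 's set \<Rightarrow> ('a \<Rightarrow> 's \<Rightarrow> real) \<Rightarrow> bool" where
  "lipschitz_pou l C X d S f \<longleftrightarrow>
     (\<forall>x\<in>X. \<forall>y\<in>X. l1_dist S (f x) (f y) \<le> l * d x y + C)"

definition property_A_witness ::
  "real \<Rightarrow> 'a set \<Rightarrow> ('a \<Rightarrow> 'a \<Rightarrow> real) \<Rightarrow> 's set \<Rightarrow> ('a \<Rightarrow> 's \<Rightarrow> real) \<Rightarrow> bool" where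
  "property_A_witness \<epsilon> X d S f \<longleftrightarrow>
     partition_of_unity X S f \<and> lipschitz_pou \<epsilon> \<epsilon> X d S f \<and>
     barycentric X S f \<and> cobounded X d S f"

text \<open>HOL cannot quantify over the type of the elements of \<open>S\<close>. Taking \<open>S\<close> inside
  \<open>'a \<times> nat\<close> loses nothing: a partition of unity on \<open>X\<close> has at most \<open>|X| \<cdot> \<aleph>\<^sub>0\<close> vertices
  in its supports; see \<open>property_A_witness_reindex\<close> below.\<close>

definition property_A :: "'a set \<Rightarrow> ('a \<Rightarrow> 'a \<Rightarrow> real) \<Rightarrow> bool" where
  "property_A X d \<longleftrightarrow>
     (\<forall>\<epsilon>>0. \<exists>(S :: ('a \<times> nat) set) f. property_A_witness \<epsilon> X d S f)"

lemma property_A_witness_reindex: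
  fixes S :: "'s set" and f :: "'a \<Rightarrow> 's \<Rightarrow> real"
  assumes "property_A_witness \<epsilon> X d S f"
  shows "\<exists>(S' :: ('a \<times> nat) set) f'. property_A_witness \<epsilon> X d S' f'"
proof -
  define supp where "supp x = {v\<in>S. f x v \<noteq> 0}" for x
  define T where "T = (\<Union>x\<in>X. supp x)"
  define c where "c v = (SOME x. x \<in> X \<and> v \<in> supp x)" for v
  define g where "g v = (c v, to_nat_on (supp (c v)) v)" for v
  define h where "h = inv_into T g"
  define f' where "f' x w = (if w \<in> g ` T then f x (h w) else 0)" for x w
  have pou: "f x \<in> Delta S" if "x \<in> X" for x
    using assms that by (auto simp: property_A_witness_def partition_of_unity_def)
  have fin: "finite (supp x)" if "x \<in> X" for x
    using pou[OF that] by (simp add: Delta_def supp_def)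
  have c: "c v \<in> X \<and> v \<in> supp (c v)" if "v \<in> T" for v
    unfolding c_def by (rule someI_ex) (use that in \<open>auto simp: T_def\<close>)
  have TS: "T \<subseteq> S" by (auto simp: T_def supp_def)
  have inj: "inj_on g T"
  proof (rule inj_onI)
    fix v w assume vw: "v \<in> T" "w \<in> T" "g v = g w"
    then have eq: "c v = c w" "to_nat_on (supp (c v)) v = to_nat_on (supp (c v)) w"
      by (auto simp: g_def)
    have "inj_on (to_nat_on (supp (c v))) (supp (c v))"
      by (intro inj_on_to_nat_on countable_finite fin) (use c vw in auto)
    then show "v = w" using eq c[OF vw(1)] c[OF vw(2)] by (metis inj_onD)
  qed
  have f'g: "f' x (g v) = f x v" if "v \<in> T" for x v
    using that inj by (simp add: f'_def h_def)
  have zero: "f x v = 0" if "x \<in> X" "v \<notin> T" for x v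
    using that pou[OF that(1)] by (cases "v \<in> S") (auto simp: T_def supp_def Delta_def)
  have supp': "{w \<in> g ` T. f' x w \<noteq> 0} = g ` supp x" if "x \<in> X" for x
  proof -
    have "v \<in> supp x \<longleftrightarrow> f' x (g v) \<noteq> 0" if "v \<in> T" for v
      using that TS by (auto simp: supp_def f'g)
    moreover have "supp x \<subseteq> T" using that by (auto simp: T_def)
    ultimately show ?thesis by blast
  qed
  have suppT: "supp x \<subseteq> T" if "x \<in> X" for x using that by (auto simp: T_def)
  have Delta': "f' x \<in> Delta (g ` T)" if x: "x \<in> X" for x
  proof -
    have "(\<Sum>w\<in>g ` supp x. f' x w) = (\<Sum>v\<in>supp x. f' x (g v))"
      using sum.reindex[OF inj_on_subset[OF inj suppT[OF x]], of "f' x"] by simp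
    also have "\<dots> = (\<Sum>v\<in>supp x. f x v)"
      using suppT[OF x] by (intro sum.cong) (auto simp: f'g)
    also have "\<dots> = 1" using pou[OF x] by (simp add: Delta_def supp_def)
    finally have "(\<Sum>w\<in>g ` supp x. f' x w) = 1" .
    moreover have "f' x \<in> g ` T \<rightarrow> {0..1}"
      using pou[OF x] TS by (auto simp: Delta_def f'g Pi_iff)
    ultimately show ?thesis
      unfolding Delta_def supp'[OF x] mem_Collect_eq
      using fin[OF x] by (auto simp: f'_def)
  qed
  have l1: "l1_dist (g ` T) (f' x) (f' y) = l1_dist S (f x) (f y)" if "x \<in> X" "y \<in> X" for x y
  proof -
    have "l1_dist (g ` T) (f' x) (f' y) = (\<Sum>\<^sub>\<infinity>v\<in>T. \<bar>f' x (g v) - f' y (g v)\<bar>)"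
      unfolding l1_dist_def by (subst infsum_reindex[OF inj]) (simp add: o_def)
    also have "\<dots> = (\<Sum>\<^sub>\<infinity>v\<in>T. \<bar>f x v - f y v\<bar>)"
      by (intro infsum_cong) (simp add: f'g)
    also have "\<dots> = (\<Sum>\<^sub>\<infinity>v\<in>S. \<bar>f x v - f y v\<bar>)"
      by (rule infsum_cong_neutral) (use TS zero that in auto)
    finally show ?thesis by (simp add: l1_dist_def)
  qed
  have star: "X \<inter> f' -` st (g ` T) (g v) = X \<inter> f -` st S v" if "v \<in> T" for v
    using that pou Delta' by (auto simp: st_def f'g)
  have "partition_of_unity X (g ` T) f'"
    using Delta' by (simp add: partition_of_unity_def)
  moreover have "lipschitz_pou \<epsilon> \<epsilon> X d (g ` T) f'"
    using assms by (simp add: property_A_witness_def lipschitz_pou_def l1)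
  moreover have "barycentric X (g ` T) f'"
    using assms TS by (simp add: property_A_witness_def barycentric_def f'g subset_iff)
  moreover have "cobounded X d (g ` T) f'"
  proof -
    obtain M where "M > 0" "\<forall>v\<in>S. ediam d (X \<inter> f -` st S v) \<le> ennreal M"
      using assms by (auto simp: property_A_witness_def cobounded_def)
    then show ?thesis
      unfolding cobounded_def using TS star by (intro exI[of _ M]) auto
  qed
  ultimately show ?thesis unfolding property_A_witness_def by blast
qed

section \<open>Countable asymptotic dimension\<close>

definition R_disjoint :: "('a \<Rightarrow> 'a \<Rightarrow> real) \<Rightarrow> real \<Rightarrow> 's set \<Rightarrow> ('s \<Rightarrow> 'a set) \<Rightarrow> bool" where
  "R_disjoint d R S U \<longleftrightarrow>
     (\<forall>s\<in>S. \<forall>t\<in>S. s \<noteq> t \<longrightarrow> (\<forall>x\<in>U s. \<forall>y\<in>U t. d x y > R))"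

text \<open>A set \<open>\<W>\<close> of sets is a family indexed by itself via \<open>id\<close>. The sequences \<open>n\<close>, \<open>R\<close>, \<open>\<V>\<close>
  start at index 1; their values at 0 are irrelevant.\<close>

definition countable_asdim :: "'a set \<Rightarrow> ('a \<Rightarrow> 'a \<Rightarrow> real) \<Rightarrow> bool" where
  "countable_asdim X d \<longleftrightarrow>
     (\<exists>n :: nat \<Rightarrow> nat. (\<forall>i\<ge>1. n i \<ge> 1) \<and>
       (\<forall>R :: nat \<Rightarrow> real. (\<forall>i\<ge>1. R i > 0) \<longrightarrow>
         (\<exists>\<V> :: nat \<Rightarrow> 'a set set.
            (\<forall>i\<ge>1. \<forall>U\<in>\<V> i. U \<subseteq> X) \<and>
            \<V> 1 = {X} \<and>
            (\<forall>i\<ge>1. \<forall>U\<in>\<V> i. \<exists>\<F>. finite \<F> \<and> card \<F> \<le> n i \<and>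
               (\<forall>\<W>\<in>\<F>. \<W> \<subseteq> \<V> (i + 1) \<and> R_disjoint d (R i) \<W> id) \<and>
               U = \<Union> (\<Union> \<F>)) \<and>
            (\<exists>i\<ge>1. uniformly_bounded_family d (\<V> i)))))"

end

theory Submission
  imports Defs
begin

text \<open>Fix \<open>R = 2 / \<epsilon>\<close>. For each level \<open>k\<close> one finds a finite set \<open>\<Omega>\<close> of parameters and, for every
  \<open>\<omega> \<in> \<Omega>\<close>, a choice \<open>h \<omega> x \<in> \<V> k\<close> of a set close to \<open>x\<close> such that \<open>R\<close>-close points are given
  the same set by all but a small proportion of the \<open>\<omega>\<close>. To pass from \<open>U = h \<omega> x\<close> to the next level,
  order the subfamilies that cover \<open>U\<close> and, for \<open>t < T\<close>, take the first subfamily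
  whose \<open>(r + t R)\<close>-neighbourhood contains \<open>x\<close>; disjointness determines the member. The index
  of this subfamily decreases in \<open>t\<close>, and for \<open>R\<close>-close points the two indices interlace, so they
  differ for few \<open>t\<close>. When \<open>\<V> k\<close> is uniformly bounded, the uniform distribution on the graph
  \<open>{(\<omega>, h \<omega> x)}\<close> is the required barycentric partition of unity.\<close>

section \<open>Choosing a nearby member of a disjoint subfamily\<close>

text \<open>Interlacing bounds both \<open>a (Suc t)\<close> and \<open>b (Suc t)\<close> by
  \<open>min (a t) (b t)\<close>, so the potential \<open>a t + b t\<close> drops by at least 1
  whenever \<open>a t\<close> and \<open>b t\<close> differ. The bound is independent of
  \<open>T\<close>.\<close>

lemma card_neq_interlacing:
  fixes a b :: "nat \<Rightarrow> nat"
  assumes "\<And>t. a (Suc t) \<le> a t" "\<And>t. b (Suc t) \<le> b t"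
    and "\<And>t. a (Suc t) \<le> b t" "\<And>t. b (Suc t) \<le> a t"
  shows "card {t. t < T \<and> a t \<noteq> b t} \<le> a 0 + b 0"
proof -
  have "card {t. t < T \<and> a t \<noteq> b t} + a T + b T \<le> a 0 + b 0"
  proof (induction T)
    case (Suc T)
    have "{t. t < Suc T \<and> a t \<noteq> b t} =
        (if a T = b T then {t. t < T \<and> a t \<noteq> b t} else insert T {t. t < T \<and> a t \<noteq> b t})"
      by (auto simp: less_Suc_eq)
    then show ?case
      using Suc assms[of T] by auto
  qed simp
  then show ?thesis by simp
qed

text \<open>Indices of subfamilies are below \<open>n\<close>, so at most \<open>2 * n\<close>
  values of \<open>t\<close> are bad however large \<open>T\<close> is. The bound on
  \<open>\<rho>\<close> is twice the largest radius plus \<open>R\<close>: distinct members of one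
  subfamily are too far apart to be selected by \<open>R\<close>-close points.\<close>

lemma (in Metric_space) neighbour_choice:
  fixes r R \<rho> :: real and n T :: nat
  assumes "finite \<F>" "card \<F> \<le> n"
    and sub: "\<And>\<W> W. \<W> \<in> \<F> \<Longrightarrow> W \<in> \<W> \<Longrightarrow> W \<subseteq> M"
    and disj: "\<And>\<W>. \<W> \<in> \<F> \<Longrightarrow> R_disjoint d \<rho> \<W> id"
    and "0 \<le> R" and \<rho>: "2 * (r + real T * R) + R \<le> \<rho>"
  obtains g :: "nat \<Rightarrow> 'a \<Rightarrow> 'a set" where
    "\<And>t x. \<lbrakk>t < T; \<exists>u\<in>\<Union>(\<Union>\<F>). d x u \<le> r\<rbrakk> \<Longrightarrow>
      g t x \<in> \<Union>\<F> \<and> (\<exists>w\<in>g t x. d x w \<le> r + real T * R)"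
    "\<And>x y. \<lbrakk>x \<in> M; y \<in> M; \<exists>u\<in>\<Union>(\<Union>\<F>). d x u \<le> r; \<exists>u\<in>\<Union>(\<Union>\<F>). d y u \<le> r; d x y \<le> R\<rbrakk> \<Longrightarrow>
      card {t. t < T \<and> g t x \<noteq> g t y} \<le> 2 * n"
proof -
  define near where "near x \<longleftrightarrow> (\<exists>u\<in>\<Union>(\<Union>\<F>). d x u \<le> r)" for x
  obtain e where e: "bij_betw e {..<card \<F>} \<F>"
    using ex_bij_betw_nat_finite[OF \<open>finite \<F>\<close>] by (auto simp: lessThan_atLeast0)
  define Q where "Q t x j \<longleftrightarrow> j < card \<F> \<and> (\<exists>W\<in>e j. \<exists>w\<in>W. d x w \<le> r + real t * R)" for t x j
  define J where "J t x = (LEAST j. Q t x j)" for t x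
  define g where "g t x = (SOME W. W \<in> e (J t x) \<and> (\<exists>w\<in>W. d x w \<le> r + real t * R))" for t x
  have mono: "r + real t * R \<le> r + real t' * R" if "t \<le> t'" for t t'
    using that \<open>0 \<le> R\<close> by (simp add: mult_right_mono)
  have exQ: "\<exists>j. Q t x j" if "near x" for t x
  proof -
    obtain u W \<W> where u: "\<W> \<in> \<F>" "W \<in> \<W>" "u \<in> W" "d x u \<le> r"
      using \<open>near x\<close> unfolding near_def by blast
    moreover obtain j where "j < card \<F>" "e j = \<W>"
      using e u(1) by (metis bij_betw_def imageE lessThan_iff)
    ultimately show ?thesis
      using mono[of 0 t] unfolding Q_def by (intro exI[of _ j]) force
  qed
  have QJ: "Q t x (J t x)" if "near x" for t x
    unfolding J_def using exQ[OF that] by (rule LeastI_ex)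
  have J_le: "J t x \<le> j" if "Q t x j" for t x j
    unfolding J_def using that by (rule Least_le)
  have g: "g t x \<in> e (J t x) \<and> (\<exists>w\<in>g t x. d x w \<le> r + real t * R)" if "near x" for t x
    unfolding g_def by (rule someI_ex) (use QJ[OF that, of t] in \<open>auto simp: Q_def\<close>)
  have eF: "e (J t x) \<in> \<F>" if "near x" for t x
    using QJ[OF that] e by (auto simp: Q_def bij_betw_def)
  have Q_shift: "Q (Suc t) y j"
    if "Q t x j" "x \<in> M" "y \<in> M" "d x y \<le> R" for t x y j
  proof -
    obtain W w where w: "j < card \<F>" "W \<in> e j" "w \<in> W" "d x w \<le> r + real t * R"
      using \<open>Q t x j\<close> by (auto simp: Q_def)
    have "e j \<in> \<F>" using e w(1) by (auto simp: bij_betw_def)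
    then have "w \<in> M" using sub w by blast
    then have "d y w \<le> r + real (Suc t) * R"
      using w(4) that triangle[of y x w] by (simp add: commute algebra_simps)
    then show ?thesis using w by (auto simp: Q_def)
  qed
  \<comment> \<open>Enlarging the radius by \<open>R\<close> absorbs the move from \<open>x\<close>
    to \<open>y\<close>. The case \<open>y = x\<close> gives monotonicity in \<open>t\<close>, the
    general case the interlacing.\<close>
  have J_shift: "J (Suc t) y \<le> J t x" if "near x" "x \<in> M" "y \<in> M" "d x y \<le> R" for t x y
    using J_le[OF Q_shift[OF QJ]] that by blast
  have g_eq: "g t x = g t y"
    if "near x" "near y" "x \<in> M" "y \<in> M" "d x y \<le> R" "t < T" "J t x = J t y" for t x y
  proof (rule ccontr)
    assume "g t x \<noteq> g t y"
    obtain w w' where w: "w \<in> g t x" "d x w \<le> r + real t * R"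
      and w': "w' \<in> g t y" "d y w' \<le> r + real t * R"
      using g \<open>near x\<close> \<open>near y\<close> by blast
    have mem: "g t x \<in> e (J t x)" "g t y \<in> e (J t x)" "e (J t x) \<in> \<F>"
      using g[of x t] g[of y t] eF[of x t] that by auto
    then have M: "w \<in> M" "w' \<in> M"
      using sub w(1) w'(1) by blast+
    have "d w w' > \<rho>"
      using disj[OF mem(3)] mem(1,2) \<open>g t x \<noteq> g t y\<close> w(1) w'(1) by (auto simp: R_disjoint_def)
    moreover have "d w w' \<le> d w x + d x y + d y w'"
      using triangle[of w x w'] triangle[of x y w'] M that by linarith
    moreover have "d w x = d x w"
      by (rule commute)
    ultimately show False
      using w(2) w'(2) \<rho> mono[of t T] \<open>t < T\<close> \<open>d x y \<le> R\<close> by simp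
  qed
  show thesis
  proof (rule that[of g]; fold near_def)
    fix t x assume "t < T" "near x"
    then show "g t x \<in> \<Union>\<F> \<and> (\<exists>w\<in>g t x. d x w \<le> r + real T * R)"
      using g[of x t] eF[of x t] mono[of t T] by (meson UnionI less_imp_le order_trans)
  next
    fix x y assume xy: "x \<in> M" "y \<in> M" "near x" "near y" "d x y \<le> R"
    then have yx: "d y x \<le> R" by (simp add: commute)
    have "card {t. t < T \<and> g t x \<noteq> g t y} \<le> card {t. t < T \<and> J t x \<noteq> J t y}"
      using g_eq xy by (intro card_mono) auto
    also have "\<dots> \<le> J 0 x + J 0 y"
      using J_shift xy yx \<open>0 \<le> R\<close> by (intro card_neq_interlacing) auto
    also have "\<dots> \<le> 2 * n"
      using QJ[of x 0] QJ[of y 0] xy \<open>card \<F> \<le> n\<close> by (auto simp: Q_def)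
    finally show "card {t. t < T \<and> g t x \<noteq> g t y} \<le> 2 * n" .
  qed
qed

section \<open>Almost invariant choices and their refinement\<close>

text \<open>Only closeness of \<open>h \<omega> x\<close> to \<open>x\<close> is asked, not
  membership, because each refinement selects through enlarged neighbourhoods.\<close>

definition almost_invariant_choice ::
  "'a set \<Rightarrow> ('a \<Rightarrow> 'a \<Rightarrow> real) \<Rightarrow> real \<Rightarrow> 'a set set \<Rightarrow> real \<Rightarrow> real \<Rightarrow> 'i set \<Rightarrow> ('i \<Rightarrow> 'a \<Rightarrow> 'a set) \<Rightarrow> bool"
  where
  "almost_invariant_choice X d R \<V> r \<delta> \<Omega> h \<longleftrightarrow>
     finite \<Omega> \<and> \<Omega> \<noteq> {} \<and>
     (\<forall>\<omega>\<in>\<Omega>. \<forall>x\<in>X. h \<omega> x \<in> \<V> \<and> (\<exists>w\<in>h \<omega> x. d x w \<le> r)) \<and>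
     (\<forall>x\<in>X. \<forall>y\<in>X. d x y \<le> R \<longrightarrow>
        real (card {\<omega>\<in>\<Omega>. h \<omega> x \<noteq> h \<omega> y}) \<le> \<delta> * real (card \<Omega>))"

text \<open>A pair \<open>(\<omega>, t)\<close> is bad either because \<open>\<omega>\<close> was
  bad already, a proportion at most \<open>\<delta>\<close>, or because \<open>t\<close> is one of
  at most \<open>2 * n\<close> bad values for the common set, a proportion at most
  \<open>2 * n / T\<close>, hence at most \<open>\<eta>\<close>.\<close>

lemma (in Metric_space) almost_invariant_choice_refine:
  fixes \<V> \<V>' :: "'a set set" and n T :: nat and \<Omega> :: "'i set"
  assumes ch: "almost_invariant_choice M d R \<V> r \<delta> \<Omega> h"
    and split: "\<And>U. U \<in> \<V> \<Longrightarrow> \<exists>\<F>. finite \<F> \<and> card \<F> \<le> n \<and>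
       (\<forall>\<W>\<in>\<F>. \<W> \<subseteq> \<V>' \<and> R_disjoint d \<rho> \<W> id) \<and> U = \<Union>(\<Union>\<F>)"
    and sub: "\<And>W. W \<in> \<V>' \<Longrightarrow> W \<subseteq> M"
    and "0 \<le> R" "2 * (r + real T * R) + R \<le> \<rho>" "0 < T" and \<eta>: "2 * real n \<le> \<eta> * real T"
  shows "\<exists>h'. almost_invariant_choice M d R \<V>' (r + real T * R) (\<delta> + \<eta>) (\<Omega> \<times> {..<T}) h'"
proof -
  have fin: "finite \<Omega>" "\<Omega> \<noteq> {}"
    and h: "\<And>\<omega> x. \<omega> \<in> \<Omega> \<Longrightarrow> x \<in> M \<Longrightarrow> h \<omega> x \<in> \<V> \<and> (\<exists>w\<in>h \<omega> x. d x w \<le> r)"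
    and inv: "\<And>x y. x \<in> M \<Longrightarrow> y \<in> M \<Longrightarrow> d x y \<le> R \<Longrightarrow>
      real (card {\<omega>\<in>\<Omega>. h \<omega> x \<noteq> h \<omega> y}) \<le> \<delta> * real (card \<Omega>)"
    using ch by (auto simp: almost_invariant_choice_def)
  \<comment> \<open>The choice is made once per \<open>U\<close>, not per point: two points with the
    same coarse set \<open>U\<close> must be refined by the same function.\<close>
  have *: "\<forall>U\<in>\<V>. \<exists>g. (\<forall>t x. t < T \<longrightarrow> (\<exists>u\<in>U. d x u \<le> r) \<longrightarrow>
        g t x \<in> \<V>' \<and> (\<exists>w\<in>g t x. d x w \<le> r + real T * R)) \<and>
      (\<forall>x y. x \<in> M \<longrightarrow> y \<in> M \<longrightarrow> (\<exists>u\<in>U. d x u \<le> r) \<longrightarrow> (\<exists>u\<in>U. d y u \<le> r) \<longrightarrow> d x y \<le> R \<longrightarrow>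
        card {t. t < T \<and> g t x \<noteq> g t y} \<le> 2 * n)"
    (is "\<forall>U\<in>\<V>. \<exists>g. ?P U g")
  proof
    fix U assume U: "U \<in> \<V>"
    obtain \<F> where \<F>: "finite \<F>" "card \<F> \<le> n"
      "\<And>\<W>. \<W> \<in> \<F> \<Longrightarrow> \<W> \<subseteq> \<V>' \<and> R_disjoint d \<rho> \<W> id" "U = \<Union>(\<Union>\<F>)"
      using split[OF U] by blast
    obtain g where
      "\<And>t x. t < T \<Longrightarrow> \<exists>u\<in>U. d x u \<le> r \<Longrightarrow>
        g t x \<in> \<Union>\<F> \<and> (\<exists>w\<in>g t x. d x w \<le> r + real T * R)"
      "\<And>x y. x \<in> M \<Longrightarrow> y \<in> M \<Longrightarrow> \<exists>u\<in>U. d x u \<le> r \<Longrightarrow> \<exists>u\<in>U. d y u \<le> r \<Longrightarrow> d x y \<le> R \<Longrightarrow>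
        card {t. t < T \<and> g t x \<noteq> g t y} \<le> 2 * n"
      unfolding \<F>(4)
      by (rule neighbour_choice[of \<F> n \<rho> R r T]) (use \<F> sub assms in \<open>blast+\<close>)
    then show "\<exists>g. ?P U g"
      using \<F>(3) by (intro exI[of _ g]) blast
  qed
  from bchoice[OF *] obtain G where G: "\<forall>U\<in>\<V>. ?P U (G U)" ..
  have G_mem: "G U t x \<in> \<V>' \<and> (\<exists>w\<in>G U t x. d x w \<le> r + real T * R)"
    if "U \<in> \<V>" "t < T" "\<exists>u\<in>U. d x u \<le> r" for U t x
    using bspec[OF G that(1)] that(2,3) by blast
  have G_card: "card {t. t < T \<and> G U t x \<noteq> G U t y} \<le> 2 * n"
    if "U \<in> \<V>" "x \<in> M" "y \<in> M" "\<exists>u\<in>U. d x u \<le> r" "\<exists>u\<in>U. d y u \<le> r" "d x y \<le> R" for U x y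
    using bspec[OF G that(1)] that(2-) by blast
  define h' where "h' p x = G (h (fst p) x) (snd p) x" for p x
  have "real (card {p\<in>\<Omega> \<times> {..<T}. h' p x \<noteq> h' p y}) \<le> (\<delta> + \<eta>) * real (card (\<Omega> \<times> {..<T}))"
    if xy: "x \<in> M" "y \<in> M" "d x y \<le> R" for x y
  proof -
    let ?B = "{\<omega>\<in>\<Omega>. h \<omega> x \<noteq> h \<omega> y}"
    let ?D = "\<lambda>\<omega>. {t. t < T \<and> G (h \<omega> x) t x \<noteq> G (h \<omega> x) t y}"
    have "{p\<in>\<Omega> \<times> {..<T}. h' p x \<noteq> h' p y} \<subseteq> ?B \<times> {..<T} \<union> Sigma (\<Omega> - ?B) ?D"
      by (auto simp: h'_def)
    then have "card {p\<in>\<Omega> \<times> {..<T}. h' p x \<noteq> h' p y} \<le> card (?B \<times> {..<T} \<union> Sigma (\<Omega> - ?B) ?D)"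
      using fin by (intro card_mono) auto
    also have "\<dots> \<le> card (?B \<times> {..<T}) + card (Sigma (\<Omega> - ?B) ?D)"
      by (rule card_Un_le)
    also have "card (Sigma (\<Omega> - ?B) ?D) = (\<Sum>\<omega>\<in>\<Omega> - ?B. card (?D \<omega>))"
      using fin by (intro card_SigmaI) auto
    also have "\<dots> \<le> (\<Sum>\<omega>\<in>\<Omega> - ?B. 2 * n)"
    proof (rule sum_mono)
      fix \<omega> assume "\<omega> \<in> \<Omega> - ?B"
      then show "card (?D \<omega>) \<le> 2 * n"
        using h[of \<omega> x] h[of \<omega> y] xy by (intro G_card) auto
    qed
    also have "\<dots> \<le> card \<Omega> * (2 * n)"
      using fin by (simp add: card_mono)
    finally have "card {p\<in>\<Omega> \<times> {..<T}. h' p x \<noteq> h' p y}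
        \<le> card ?B * T + card \<Omega> * (2 * n)"
      by (simp add: card_cartesian_product)
    from of_nat_mono[OF this, where 'a = real]
    have "real (card {p\<in>\<Omega> \<times> {..<T}. h' p x \<noteq> h' p y})
        \<le> real (card ?B) * real T + real (card \<Omega>) * (2 * real n)"
      by simp
    also have "\<dots> \<le> \<delta> * real (card \<Omega>) * real T + real (card \<Omega>) * (\<eta> * real T)"
      using inv[OF xy] \<eta> by (intro add_mono mult_right_mono mult_left_mono) auto
    finally show ?thesis
      by (simp add: card_cartesian_product algebra_simps)
  qed
  moreover have "h' p x \<in> \<V>' \<and> (\<exists>w\<in>h' p x. d x w \<le> r + real T * R)"
    if "p \<in> \<Omega> \<times> {..<T}" "x \<in> M" for p x
    unfolding h'_def using that h by (intro G_mem) auto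
  ultimately have "almost_invariant_choice M d R \<V>' (r + real T * R) (\<delta> + \<eta>) (\<Omega> \<times> {..<T}) h'"
    unfolding almost_invariant_choice_def using fin \<open>0 < T\<close> by blast
  then show ?thesis by blast
qed

text \<open>A refinement turns parameters into pairs, which changes their type. Reindexing along an
  injection such as \<open>prod_encode\<close> keeps the induction over levels inside
  \<open>nat set\<close>.\<close>

lemma almost_invariant_choice_reindex:
  assumes "almost_invariant_choice X d R \<V> r \<delta> \<Omega> h" and inj: "inj f"
  shows "almost_invariant_choice X d R \<V> r \<delta> (f ` \<Omega>) (h \<circ> inv f)"
proof -
  have "{\<omega> \<in> f ` \<Omega>. (h \<circ> inv f) \<omega> x \<noteq> (h \<circ> inv f) \<omega> y} = f ` {\<omega>\<in>\<Omega>. h \<omega> x \<noteq> h \<omega> y}" for x y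
    using inj by auto
  then show ?thesis
    using assms by (simp add: almost_invariant_choice_def card_image inj_on_subset[OF inj])
qed

section \<open>From choices to partitions of unity\<close>

text \<open>Tagging each chosen set with its parameter gives every point exactly
  \<open>card \<Omega>\<close> vertices, all of weight \<open>1 / N\<close>, even if several
  parameters choose the same set.\<close>

lemma (in Metric_space) property_A_witness_of_choice:
  fixes \<Omega> :: "'i set"
  assumes ch: "almost_invariant_choice M d R \<V> r (\<epsilon> / 2) \<Omega> h"
    and "0 < \<epsilon>" "2 / \<epsilon> \<le> R" and bdd: "uniformly_bounded_family d \<V>"
    and sub: "\<And>W. W \<in> \<V> \<Longrightarrow> W \<subseteq> M"
  shows "\<exists>f. property_A_witness \<epsilon> M d (\<Omega> \<times> \<V>) f"
proof -
  have fin: "finite \<Omega>" "\<Omega> \<noteq> {}"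
    and h: "\<And>\<omega> x. \<omega> \<in> \<Omega> \<Longrightarrow> x \<in> M \<Longrightarrow> h \<omega> x \<in> \<V> \<and> (\<exists>w\<in>h \<omega> x. d x w \<le> r)"
    and inv: "\<And>x y. x \<in> M \<Longrightarrow> y \<in> M \<Longrightarrow> d x y \<le> R \<Longrightarrow>
      real (card {\<omega>\<in>\<Omega>. h \<omega> x \<noteq> h \<omega> y}) \<le> \<epsilon> / 2 * real (card \<Omega>)"
    using ch by (auto simp: almost_invariant_choice_def)
  define N where "N = real (card \<Omega>)"
  have N: "N \<ge> 1" using fin by (simp add: N_def Suc_le_eq card_gt_0_iff)
  define f where "f x p = (if fst p \<in> \<Omega> \<and> snd p = h (fst p) x then 1 / N else 0)" for x p
  define A where "A x = (\<lambda>\<omega>. (\<omega>, h \<omega> x)) ` \<Omega>" for x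
  have supp: "{p \<in> \<Omega> \<times> \<V>. f x p \<noteq> 0} = A x" if "x \<in> M" for x
    using h that N by (auto simp: f_def A_def)
  have "f x \<in> Delta (\<Omega> \<times> \<V>)" if x: "x \<in> M" for x
  proof -
    have "(\<Sum>p\<in>A x. f x p) = (\<Sum>\<omega>\<in>\<Omega>. f x (\<omega>, h \<omega> x))"
      unfolding A_def by (subst sum.reindex) (auto simp: inj_on_def)
    also have "\<dots> = 1" using N by (simp add: f_def N_def)
    finally have "(\<Sum>p\<in>A x. f x p) = 1" .
    moreover have "finite (A x)" using fin by (simp add: A_def)
    moreover have "f x p = 0" if "p \<notin> \<Omega> \<times> \<V>" for p
      using that h x by (cases p) (auto simp: f_def)
    moreover have "f x \<in> \<Omega> \<times> \<V> \<rightarrow> {0..1}" using N by (auto simp: f_def)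
    ultimately show ?thesis
      unfolding Delta_def supp[OF x] mem_Collect_eq by blast
  qed
  then have "partition_of_unity M (\<Omega> \<times> \<V>) f"
    by (simp add: partition_of_unity_def)
  moreover have "barycentric M (\<Omega> \<times> \<V>) f"
    by (auto simp: barycentric_def f_def)
  moreover have "lipschitz_pou \<epsilon> \<epsilon> M d (\<Omega> \<times> \<V>) f"
    unfolding lipschitz_pou_def
  proof (intro ballI)
    fix x y assume xy: "x \<in> M" "y \<in> M"
    let ?B = "{\<omega>\<in>\<Omega>. h \<omega> x \<noteq> h \<omega> y}"
    let ?G = "\<lambda>z. (\<lambda>\<omega>. (\<omega>, h \<omega> z)) ` ?B"
    have G: "finite (?G z)" "card (?G z) \<le> card ?B" for z
      using fin by (auto intro: card_image_le)
    \<comment> \<open>Where the choices for \<open>x\<close> and \<open>y\<close> agree, their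
      graphs share the vertex and the weight, so only the parameters in \<open>?B\<close>
      contribute.\<close>
    have "l1_dist (\<Omega> \<times> \<V>) (f x) (f y) = (\<Sum>\<^sub>\<infinity>p\<in>?G x \<union> ?G y. \<bar>f x p - f y p\<bar>)"
      unfolding l1_dist_def using h xy by (intro infsum_cong_neutral) (auto simp: f_def)
    also have "\<dots> = (\<Sum>p\<in>?G x \<union> ?G y. \<bar>f x p - f y p\<bar>)"
      using G by (intro infsum_finite) blast
    also have "\<dots> \<le> (\<Sum>p\<in>?G x \<union> ?G y. 1 / N)"
      using N by (intro sum_mono) (auto simp: f_def)
    also have "\<dots> = real (card (?G x \<union> ?G y)) / N"
      by simp
    also have "\<dots> \<le> 2 * real (card ?B) / N"
      using card_Un_le[of "?G x" "?G y"] G(2)[of x] G(2)[of y] N by (intro divide_right_mono) auto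
    finally have l1: "l1_dist (\<Omega> \<times> \<V>) (f x) (f y) \<le> 2 * real (card ?B) / N" .
    show "l1_dist (\<Omega> \<times> \<V>) (f x) (f y) \<le> \<epsilon> * d x y + \<epsilon>"
    proof (cases "d x y \<le> R")
      case True
      then have "2 * real (card ?B) / N \<le> \<epsilon>"
        using inv[OF xy True] N by (simp add: N_def field_simps)
      moreover have "0 \<le> \<epsilon> * d x y" using \<open>0 < \<epsilon>\<close> by simp
      ultimately show ?thesis using l1 by linarith
    next
      \<comment> \<open>Far apart, the trivial bound 2 on the l1 distance is at most
        \<open>\<epsilon> * d x y\<close>, since \<open>R\<close> is at least
        \<open>2 / \<epsilon>\<close>.\<close>
      case False
      have "real (card ?B) \<le> N" unfolding N_def using fin by (simp add: card_mono)
      then have "2 * real (card ?B) / N \<le> 2" using N by (simp add: field_simps)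
      moreover have "2 / \<epsilon> \<le> d x y" using False \<open>2 / \<epsilon> \<le> R\<close> by linarith
      then have "2 \<le> \<epsilon> * d x y" using \<open>0 < \<epsilon>\<close> by (simp add: field_simps)
      ultimately show ?thesis using l1 \<open>0 < \<epsilon>\<close> by linarith
    qed
  qed
  moreover have "cobounded M d (\<Omega> \<times> \<V>) f"
  proof -
    obtain B where "\<And>U. U \<in> \<V> \<Longrightarrow> ediam d U \<le> ennreal B"
      using bdd by (auto simp: uniformly_bounded_family_def)
    \<comment> \<open>The bound \<open>B\<close> may be negative, in which case
      \<open>ennreal B\<close> is 0; \<open>ediam_le_iff\<close> needs a nonnegative one.\<close>
    then have "\<And>U. U \<in> \<V> \<Longrightarrow> ediam d U \<le> ennreal (max B 0)"
      by (meson ennreal_leI max.cobounded1 order_trans)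
    then have B: "\<And>U u v. U \<in> \<V> \<Longrightarrow> u \<in> U \<Longrightarrow> v \<in> U \<Longrightarrow> d u v \<le> max B 0"
      by (simp add: ediam_le_iff)
    \<comment> \<open>Points sharing a vertex are both within \<open>r\<close> of one member of the
      bounded family; \<open>\<bar>r\<bar>\<close> and the summand 1 make \<open>K\<close>
      positive.\<close>
    define K where "K = 2 * \<bar>r\<bar> + max B 0 + 1"
    have "d x y \<le> K"
      if "p \<in> \<Omega> \<times> \<V>" and x: "x \<in> M" "f x p > 0" and y: "y \<in> M" "f y p > 0" for p x y
    proof -
      obtain \<omega> where \<omega>: "\<omega> \<in> \<Omega>" "h \<omega> x = h \<omega> y"
        using x y by (auto simp: f_def split: if_splits)
      obtain u v where "u \<in> h \<omega> x" "v \<in> h \<omega> x" and uv: "d x u \<le> r" "d y v \<le> r"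
        using h[of \<omega> x] h[of \<omega> y] \<omega> x y by auto
      moreover have "h \<omega> x \<in> \<V>" using h \<omega> x by blast
      ultimately have M: "u \<in> M" "v \<in> M" and "d u v \<le> max B 0"
        using sub B by blast+
      moreover have "d x y \<le> d x u + d u v + d v y"
        using triangle[of x u y] triangle[of u v y] M x y by linarith
      ultimately show ?thesis
        unfolding K_def using uv commute[of v y] by linarith
    qed
    moreover have "0 < K" by (simp add: K_def add_nonneg_pos)
    ultimately show ?thesis
      unfolding cobounded_def
      by (intro exI[of _ K] conjI ballI) (auto simp: ediam_le_iff st_def)
  qed
  ultimately show ?thesis
    unfolding property_A_witness_def by blast
qed

section \<open>Choice of scales and induction over the levels\<close>

theorem corollary7p7:
  fixes X :: "'a set" and d :: "'a \<Rightarrow> 'a \<Rightarrow> real"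
  assumes "Metric_space X d"
    and "countable_asdim X d"
  shows "property_A X d"
  unfolding property_A_def
proof (intro allI impI)
  interpret Metric_space X d by fact
  fix \<epsilon> :: real assume "0 < \<epsilon>"
  obtain n :: "nat \<Rightarrow> nat" where n: "\<forall>R. (\<forall>i\<ge>1. R i > 0) \<longrightarrow> (\<exists>\<V>. (\<forall>i\<ge>1. \<forall>U\<in>\<V> i. U \<subseteq> X) \<and> \<V> 1 = {X} \<and>
      (\<forall>i\<ge>1. \<forall>U\<in>\<V> i. \<exists>\<F>. finite \<F> \<and> card \<F> \<le> n i \<and>
         (\<forall>\<W>\<in>\<F>. \<W> \<subseteq> \<V> (i + 1) \<and> R_disjoint d (R i) \<W> id) \<and> U = \<Union>(\<Union>\<F>)) \<and>
      (\<exists>i\<ge>1. uniformly_bounded_family d (\<V> i)))"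
    using assms(2) unfolding countable_asdim_def by (elim exE conjE) (rule that)
  define R where "R = 2 / \<epsilon>"
  \<comment> \<open>The errors for \<open>i\<close> from 1 on sum to \<open>\<epsilon> / 2\<close>.
    Since \<open>n\<close> is known before the scales are chosen, \<open>T\<close> and
    \<open>r\<close> can be fixed in advance.\<close>
  define \<eta> where "\<eta> i = \<epsilon> / 2 ^ (i + 1)" for i :: nat
  \<comment> \<open>\<open>Suc\<close> keeps \<open>T i\<close> positive, so that the refined
    parameter set is nonempty.\<close>
  define T where "T i = Suc (nat \<lceil>2 * real (n i) / \<eta> i\<rceil>)" for i
  define r where "r i = (\<Sum>j<i. real (T j) * R)" for i
  \<comment> \<open>The sum starts at 1, so \<open>\<delta> 1 = 0\<close>, matching the constant
    choice \<open>X\<close> at level 1.\<close>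
  define \<delta> where "\<delta> i = (\<Sum>j\<in>{1..<i}. \<eta> j)" for i
  have "0 < R" using \<open>0 < \<epsilon>\<close> by (simp add: R_def)
  have r_nonneg: "0 \<le> r i" for i
    unfolding r_def using \<open>0 < R\<close> by (intro sum_nonneg) auto
  have r_Suc: "r (Suc i) = r i + real (T i) * R" for i by (simp add: r_def)
  have \<eta>_pos: "0 < \<eta> i" for i using \<open>0 < \<epsilon>\<close> by (simp add: \<eta>_def)
  have T: "2 * real (n i) \<le> \<eta> i * real (T i)" for i
  proof -
    have "2 * real (n i) / \<eta> i \<le> real (T i)" unfolding T_def by linarith
    then show ?thesis using \<eta>_pos[of i] by (simp add: field_simps)
  qed
  have \<delta>: "\<delta> (Suc i) = \<epsilon> / 2 - \<epsilon> / 2 ^ (i + 1)" for i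
    by (induction i) (simp_all add: \<delta>_def \<eta>_def field_simps)
  \<comment> \<open>These are the scales fed to \<open>n\<close>: \<open>r (Suc i)\<close> is the
    largest radius used in passing from level \<open>i\<close> to the next.\<close>
  have "\<forall>i\<ge>1. 2 * r (Suc i) + R > 0"
    using r_nonneg \<open>0 < R\<close> by (simp add: add_nonneg_pos)
  from n[THEN spec, THEN mp, OF this] obtain \<V> where \<V>: "\<forall>i\<ge>1. \<forall>U\<in>\<V> i. U \<subseteq> X" "\<V> 1 = {X}"
      "\<forall>i\<ge>1. \<forall>U\<in>\<V> i. \<exists>\<F>. finite \<F> \<and> card \<F> \<le> n i \<and>
         (\<forall>\<W>\<in>\<F>. \<W> \<subseteq> \<V> (i + 1) \<and> R_disjoint d (2 * r (Suc i) + R) \<W> id) \<and> U = \<Union>(\<Union>\<F>)"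
      "\<exists>i\<ge>1. uniformly_bounded_family d (\<V> i)"
    by (rule exE) (elim conjE, rule that)
  \<comment> \<open>The bounded level may depend on the scales, which is why \<open>\<delta>\<close>
    had to stay below \<open>\<epsilon> / 2\<close> at all levels.\<close>
  from \<V>(4) obtain k where k: "uniformly_bounded_family d (\<V> (Suc k))"
    by (metis Suc_le_D One_nat_def)
  have "\<exists>(\<Omega> :: nat set) h. almost_invariant_choice X d R (\<V> (Suc i)) (r (Suc i)) (\<delta> (Suc i)) \<Omega> h" for i
  proof (induction i)
    case 0
    have "almost_invariant_choice X d R (\<V> 1) (r 1) (\<delta> 1) {0 :: nat} (\<lambda>_ _. X)"
      unfolding almost_invariant_choice_def \<V>(2) using r_nonneg[of 1]
      by (auto simp: \<delta>_def intro!: bexI)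
    then show ?case by auto
  next
    case (Suc i)
    then obtain \<Omega> :: "nat set" and h
      where "almost_invariant_choice X d R (\<V> (Suc i)) (r (Suc i)) (\<delta> (Suc i)) \<Omega> h"
      by blast
    then have "\<exists>h'. almost_invariant_choice X d R (\<V> (Suc (Suc i)))
        (r (Suc i) + real (T (Suc i)) * R) (\<delta> (Suc i) + \<eta> (Suc i)) (\<Omega> \<times> {..<T (Suc i)}) h'"
      by (rule almost_invariant_choice_refine[where n = "n (Suc i)" and \<rho> = "2 * r (Suc (Suc i)) + R"])
        (use \<V>(1)[rule_format, of "Suc (Suc i)"] \<V>(3)[rule_format, of "Suc i"] \<open>0 < R\<close> T
          in \<open>auto simp: r_Suc[of "Suc i"] T_def\<close>)
    moreover have "\<delta> (Suc i) + \<eta> (Suc i) = \<delta> (Suc (Suc i))"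
      by (simp add: \<delta>_def)
    ultimately show ?case
      using almost_invariant_choice_reindex[OF _ inj_prod_encode] by (metis r_Suc)
  qed
  then obtain \<Omega> :: "nat set" and h
    where "almost_invariant_choice X d R (\<V> (Suc k)) (r (Suc k)) (\<delta> (Suc k)) \<Omega> h"
    by blast
  moreover have "\<delta> (Suc k) \<le> \<epsilon> / 2" using \<delta> \<open>0 < \<epsilon>\<close> by simp
  ultimately have "almost_invariant_choice X d R (\<V> (Suc k)) (r (Suc k)) (\<epsilon> / 2) \<Omega> h"
    unfolding almost_invariant_choice_def by (meson mult_right_mono of_nat_0_le_iff order_trans)
  then have "\<exists>f. property_A_witness \<epsilon> X d (\<Omega> \<times> \<V> (Suc k)) f"
    using \<open>0 < \<epsilon>\<close> k \<V>(1) by (intro property_A_witness_of_choice) (auto simp: R_def)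
  \<comment> \<open>The vertices found are pairs of a number and a subset of \<open>X\<close>;
    reindexing moves them to the required type.\<close>
  then show "\<exists>(S :: ('a \<times> nat) set) f. property_A_witness \<epsilon> X d S f"
    using property_A_witness_reindex by blast
qed

end
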